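(* Let $1\leq p\leq\infty$, let $X,Y$ be Banach spaces and let $T:X\rightarrow Y$ be an operator. The following are equivalent: (1) $T$ is unconditionally $p$-converging; (2) $T$ sends weakly $p$-convergent sequences to norm convergent sequences; (3) $T$ sends weakly $p$-Cauchy sequences to norm convergent sequences.
   Context: Banach spaces are real or complex; an operator is a continuous linear map; $B_{X^{*}}$ is the closed unit ball of $X^{*}$. For $1\leq p<\infty$, a sequence $(x_n)_n$ in $X$ is weakly $p$-summable, written $(x_n)_n\in l_p^w(X)$, if $\sup\{(\sum_{n=1}^{\infty}|\langle x^*,x_n\rangle|^p)^{1/p}:x^*\in B_{X^*}\}<\infty$; it is unconditionally $p$-summable, written $(x_n)_n\in l_p^u(X)$, if moreover $\sup\{(\sum_{n=m}^{\infty}|\langle x^*,x_n\rangle|^p)^{1/p}:x^*\in B_{X^*}\}\to 0$ as $m\to\infty$. For $p=\infty$, "weakly $\infty$-summable" means weakly null and "unconditionally $\infty$-summable" means norm null. For $1\le p\le\infty$, an operator $T:X\to Y$ is unconditionally $p$-converging if it maps every weakly $p$-summable sequence in $X$ to an unconditionally $p$-summable sequence in $Y$ (for $p=\infty$: weakly null sequences to norm null sequences). A sequence $(x_n)_n$ in $X$ is weakly $p$-convergent to $x\in X$ if $(x_n-x)_n$ is weakly $p$-summable; it is weakly $p$-convergent if it is weakly $p$-convergent to some $x\in X$. A sequence $(x_n)_n$ in $X$ is weakly $p$-Cauchy if for each pair of strictly increasing sequences $(k_n)_n$, $(j_n)_n$ of positive integers, $(x_{k_n}-x_{j_n})_n$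 is weakly $p$-summable. *)

theory Defs
  imports "HOL-Analysis.Analysis"
begin

text \<open>
  Banach spaces are real or complex. The library class \<open>banach\<close> only records the real
  structure, so the scalar field is a type \<open>'k\<close> that is isometrically isomorphic to
  \<open>real\<close> or \<open>complex\<close>, and a Banach space over \<open>'k\<close> is a type of class
  \<open>banach\<close> together with a compatible scalar multiplication by \<open>'k\<close>.
\<close>

class real_or_complex = real_normed_field +
  assumes real_or_complex:
    "(\<exists>h :: 'a \<Rightarrow> real. bij h \<and> (\<forall>a b. h (a + b) = h a + h b) \<and> (\<forall>a b. h (a * b) = h a * h b) \<and>
         (\<forall>r a. h (r *\<^sub>R a) = r *\<^sub>R h a) \<and> (\<forall>a. norm (h a) = norm a)) \<or>
     (\<exists>h :: 'a \<Rightarrow> complex. bij h \<and> (\<forall>a b. h (a + b) = h a + h b) \<and> (\<forall>a b. h (a * b) = h a * h b) \<and>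
         (\<forall>r a. h (r *\<^sub>R a) = r *\<^sub>R h a) \<and> (\<forall>a. norm (h a) = norm a))"

instance real :: real_or_complex
  by standard (rule disjI1, rule exI[of _ "\<lambda>a. a"], simp add: bij_def)

instance complex :: real_or_complex
  by standard (rule disjI2, rule exI[of _ "\<lambda>a. a"], simp add: bij_def)

locale banach_space = vector_space scale
  for scale :: "'k::real_or_complex \<Rightarrow> 'a::banach \<Rightarrow> 'a" +
  assumes scale_of_real: "scale (of_real r) x = r *\<^sub>R x"
    and norm_scale: "norm (scale c x) = norm c * norm x"

lemma banach_space_scaleR: "banach_space ((*\<^sub>R) :: real \<Rightarrow> 'a::banach \<Rightarrow> 'a)"
  by unfold_locales (simp_all add: scaleR_add_right scaleR_add_left)

lemma banach_space_complex: "banach_space ((*) :: complex \<Rightarrow> complex \<Rightarrow> complex)"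
  by unfold_locales (simp_all add: algebra_simps scaleR_conv_of_real norm_mult)

definition operator_between ::
  "('k::real_or_complex \<Rightarrow> 'a::banach \<Rightarrow> 'a) \<Rightarrow> ('k \<Rightarrow> 'b::banach \<Rightarrow> 'b) \<Rightarrow> ('a \<Rightarrow> 'b) \<Rightarrow> bool" where
  "operator_between sX sY T \<longleftrightarrow> Vector_Spaces.linear sX sY T \<and> continuous_on UNIV T"

definition dual_space :: "('k::real_or_complex \<Rightarrow> 'a::banach \<Rightarrow> 'a) \<Rightarrow> ('a \<Rightarrow> 'k) set" where
  "dual_space s = {f. Vector_Spaces.linear s (*) f \<and> continuous_on UNIV f}"

definition dual_ball :: "('k::real_or_complex \<Rightarrow> 'a::banach \<Rightarrow> 'a) \<Rightarrow> ('a \<Rightarrow> 'k) set" where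
  "dual_ball s = {f \<in> dual_space s. onorm f \<le> 1}"

definition ennreal_powr :: "ennreal \<Rightarrow> real \<Rightarrow> ennreal" where
  \<comment> \<open>only used with a positive exponent, for which \<open>\<infinity>\<close> to that power is \<open>\<infinity>\<close>\<close>
  "ennreal_powr c r = (if c = \<infinity> then \<infinity> else ennreal (enn2real c powr r))"

text \<open>Sequences are indexed from \<open>0\<close>. The series below is taken in \<open>[0,\<infinity>]\<close>, so it always has a sum;
  the definition is meant for a real exponent \<open>q \<ge> 1\<close>.\<close>

definition weak_tail ::
  "('k::real_or_complex \<Rightarrow> 'a::banach \<Rightarrow> 'a) \<Rightarrow> real \<Rightarrow> (nat \<Rightarrow> 'a) \<Rightarrow> nat \<Rightarrow> ennreal" where
  "weak_tail s q x m =
     (SUP f\<in>dual_ball s. ennreal_powr (\<Sum>n. ennreal (norm (f (x (m + n))) powr q)) (1 / q))"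

definition weakly_summable ::
  "('k::real_or_complex \<Rightarrow> 'a::banach \<Rightarrow> 'a) \<Rightarrow> ennreal \<Rightarrow> (nat \<Rightarrow> 'a) \<Rightarrow> bool" where
  "weakly_summable s p x \<longleftrightarrow>
     (if p = \<infinity> then \<forall>f\<in>dual_space s. (\<lambda>n. f (x n)) \<longlonglongrightarrow> 0
      else weak_tail s (enn2real p) x 0 < \<infinity>)"

definition unconditionally_summable ::
  "('k::real_or_complex \<Rightarrow> 'a::banach \<Rightarrow> 'a) \<Rightarrow> ennreal \<Rightarrow> (nat \<Rightarrow> 'a) \<Rightarrow> bool" where
  "unconditionally_summable s p x \<longleftrightarrow>
     (if p = \<infinity> then x \<longlonglongrightarrow> 0
      else weakly_summable s p x \<and> weak_tail s (enn2real p) x \<longlonglongrightarrow> 0)"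

definition unconditionally_converging ::
  "('k::real_or_complex \<Rightarrow> 'a::banach \<Rightarrow> 'a) \<Rightarrow> ('k \<Rightarrow> 'b::banach \<Rightarrow> 'b) \<Rightarrow> ennreal \<Rightarrow> ('a \<Rightarrow> 'b) \<Rightarrow> bool" where
  "unconditionally_converging sX sY p T \<longleftrightarrow>
     (\<forall>x. weakly_summable sX p x \<longrightarrow> unconditionally_summable sY p (\<lambda>n. T (x n)))"

definition weakly_convergent_to ::
  "('k::real_or_complex \<Rightarrow> 'a::banach \<Rightarrow> 'a) \<Rightarrow> ennreal \<Rightarrow> (nat \<Rightarrow> 'a) \<Rightarrow> 'a \<Rightarrow> bool" where
  "weakly_convergent_to s p x l \<longleftrightarrow> weakly_summable s p (\<lambda>n. x n - l)"

definition weakly_convergent ::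
  "('k::real_or_complex \<Rightarrow> 'a::banach \<Rightarrow> 'a) \<Rightarrow> ennreal \<Rightarrow> (nat \<Rightarrow> 'a) \<Rightarrow> bool" where
  "weakly_convergent s p x \<longleftrightarrow> (\<exists>l. weakly_convergent_to s p x l)"

definition weakly_Cauchy ::
  "('k::real_or_complex \<Rightarrow> 'a::banach \<Rightarrow> 'a) \<Rightarrow> ennreal \<Rightarrow> (nat \<Rightarrow> 'a) \<Rightarrow> bool" where
  "weakly_Cauchy s p x \<longleftrightarrow>
     (\<forall>k j :: nat \<Rightarrow> nat. strict_mono k \<longrightarrow> strict_mono j \<longrightarrow>
        weakly_summable s p (\<lambda>n. x (k n) - x (j n)))"

end

theory Submission
  imports Defs
begin

text \<open>
  All three conditions are equivalent to a fourth one, which treats every \<open>p\<close> alike: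

    \<^item> (N) \<open>T\<close> maps weakly \<open>p\<close>-summable sequences to norm null sequences.

  That (1) implies (N) is, for finite \<open>p\<close>, the observation that a tail of the \<open>p\<close>-sums of
  a sequence \<open>(y\<^sub>n)\<close> dominates \<open>sup \<bar>f(y\<^sub>n)\<bar>\<close> over the dual ball, and this supremum is the norm of
  \<open>y\<^sub>n\<close> by the Hahn-Banach theorem (\<open>norming_functional\<close>).

  The converse (\<open>tail_null_of_norm_null\<close>) is the heart of the matter for finite \<open>p\<close>; for
  \<open>p = \<infinity>\<close> condition (N) is (1) itself. If the tails of
  \<open>(T x\<^sub>n)\<close> do not vanish, there are \<open>e > 0\<close>, successive finite blocks \<open>A\<^sub>i\<close> of indices and
  functionals \<open>f\<^sub>i\<close> in the dual ball of \<open>Y\<close> such that \<open>(f\<^sub>i(T x\<^sub>n))\<close> has \<open>\<ell>\<^sub>p\<close>-norm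
  greater than \<open>e\<close> on \<open>A\<^sub>i\<close>. By the duality of \<open>\<ell>\<^sub>p\<close> (\<open>holder_dual_coefficients\<close>) there are
  scalars \<open>a\<^sub>n\<close> which turn this norm into a pairing, so that \<open>z\<^sub>i = \<Sum> a\<^sub>n x\<^sub>n\<close>, summed over the
  block \<open>A\<^sub>i\<close>, satisfies \<open>\<parallel>T z\<^sub>i\<parallel> > e\<close>. The same scalars are contractive in the \<open>\<ell>\<^sub>p\<close> sense,
  so \<open>\<bar>g(z\<^sub>i)\<bar>\<^sup>p\<close> is at most the sum of \<open>\<bar>g(x\<^sub>n)\<bar>\<^sup>p\<close> over \<open>A\<^sub>i\<close> for every \<open>g\<close> in the dual ball
  of \<open>X\<close>. As the blocks are disjoint, \<open>(z\<^sub>i)\<close> is again weakly \<open>p\<close>-summable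
  (\<open>weakly_summable_blocks\<close>), which contradicts (N).

  (N) implies (3): if \<open>(T x\<^sub>n)\<close> is not Cauchy, two subsequences of it stay apart, whereas the
  differences of the corresponding subsequences of \<open>(x\<^sub>n)\<close> are weakly \<open>p\<close>-summable.
  (3) implies (2) because a weakly \<open>p\<close>-convergent sequence is weakly \<open>p\<close>-Cauchy.
  (2) implies (N): a weakly \<open>p\<close>-summable sequence is weakly \<open>p\<close>-convergent to \<open>0\<close>, so its
  image converges in norm; the image is also weakly null, and the limit is \<open>0\<close> because functionals
  separate points.

  The Hahn-Banach theorem is proved here in the form needed: a minimal sublinear functional is linear.
\<close>

section \<open>The Hahn-Banach theorem for sublinear functionals\<close>

definition sublinear :: "('a::real_vector \<Rightarrow> real) \<Rightarrow> bool" where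
  "sublinear q \<longleftrightarrow> (\<forall>x y. q (x + y) \<le> q x + q y) \<and> (\<forall>t x. 0 \<le> t \<longrightarrow> q (t *\<^sub>R x) = t * q x)"

lemma sublinear_zero: "sublinear q \<Longrightarrow> q 0 = 0"
  unfolding sublinear_def by (metis mult_zero_left order_refl scaleR_zero_left)

lemma sublinear_ge_neg_majorant:
  assumes "sublinear q" and "\<And>x. q x \<le> r x"
  shows "- r (- x) \<le> q x"
proof -
  have "q (x + - x) \<le> q x + q (- x)"
    using assms(1) unfolding sublinear_def by blast
  then have "0 \<le> q x + q (- x)"
    using sublinear_zero[OF assms(1)] by simp
  then show ?thesis
    using assms(2)[of "- x"] by linarith
qed

text \<open>
  A sublinear functional can be lowered towards additivity in a given direction \<open>v\<close>: take the
  infimum over \<open>t \<ge> 0\<close> of \<open>q (x + t v) - t q v\<close>. The values \<open>t = 0\<close> and \<open>t = 1\<close> give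
  the two upper bounds. If \<open>q\<close> is minimal, then \<open>r = q\<close>, and the second bound is the
  superadditivity that \<open>q\<close> lacks for being linear.
\<close>

lemma sublinear_lowering:
  fixes q :: "'a::real_vector \<Rightarrow> real"
  assumes q: "sublinear q"
  obtains r where "sublinear r" and "\<And>x. r x \<le> q x" and "\<And>x. r x \<le> q (x + v) - q v"
proof
  define r where "r x = (INF t\<in>{0..}. q (x + t *\<^sub>R v) - t * q v)" for x
  have sub: "q (x + y) \<le> q x + q y" for x y
    using q unfolding sublinear_def by blast
  have hom: "q (t *\<^sub>R x) = t * q x" if "0 \<le> t" for t x
    using q that unfolding sublinear_def by blast
  have lower: "- q (- x) \<le> q (x + t *\<^sub>R v) - t * q v" if "0 \<le> t" for x t
    using sub[of "x + t *\<^sub>R v" "- x"] hom[OF that, of v] by simp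
  have bdd: "bdd_below ((\<lambda>t. q (x + t *\<^sub>R v) - t * q v) ` {0..})" for x
    using lower by (intro bdd_belowI[of _ "- q (- x)"]) auto
  have r_le: "r x \<le> q (x + t *\<^sub>R v) - t * q v" if "0 \<le> t" for x t
    unfolding r_def using that by (intro cINF_lower[OF bdd]) auto
  have r_ge: "c \<le> r x" if "\<And>t. 0 \<le> t \<Longrightarrow> c \<le> q (x + t *\<^sub>R v) - t * q v" for c x
    unfolding r_def using that by (intro cINF_greatest) auto
  show "r x \<le> q x" for x
    using r_le[of 0 x] by simp
  show "r x \<le> q (x + v) - q v" for x
    using r_le[of 1 x] by simp
  have r_add: "r (x + y) \<le> r x + r y" for x y
  proof -
    have "r (x + y) - (q (y + u *\<^sub>R v) - u * q v) \<le> r x" if u: "0 \<le> u" for u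
    proof (rule r_ge)
      fix t :: real assume t: "0 \<le> t"
      have "r (x + y) \<le> q ((x + y) + (t + u) *\<^sub>R v) - (t + u) * q v"
        using r_le[of "t + u" "x + y"] t u by simp
      also have "(x + y) + (t + u) *\<^sub>R v = (x + t *\<^sub>R v) + (y + u *\<^sub>R v)"
        by (simp add: algebra_simps)
      finally show "r (x + y) - (q (y + u *\<^sub>R v) - u * q v) \<le> q (x + t *\<^sub>R v) - t * q v"
        using sub[of "x + t *\<^sub>R v" "y + u *\<^sub>R v"] by (simp add: algebra_simps)
    qed
    then have "r (x + y) - r x \<le> r y"
      by (intro r_ge) (simp add: algebra_simps)
    then show ?thesis by simp
  qed
  have r_scale_le: "r (s *\<^sub>R x) \<le> s * r x" if s: "0 < s" for s x
  proof -
    have "r (s *\<^sub>R x) / s \<le> r x"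
    proof (rule r_ge)
      fix t :: real assume t: "0 \<le> t"
      have "r (s *\<^sub>R x) \<le> q (s *\<^sub>R x + (s * t) *\<^sub>R v) - (s * t) * q v"
        using r_le[of "s * t"] s t by simp
      also have "s *\<^sub>R x + (s * t) *\<^sub>R v = s *\<^sub>R (x + t *\<^sub>R v)"
        by (simp add: algebra_simps)
      also have "q \<dots> - (s * t) * q v = s * (q (x + t *\<^sub>R v) - t * q v)"
        using s by (simp add: hom right_diff_distrib)
      finally show "r (s *\<^sub>R x) / s \<le> q (x + t *\<^sub>R v) - t * q v"
        using s by (simp add: field_simps)
    qed
    then show ?thesis
      using s by (simp add: field_simps)
  qed
  have "r (s *\<^sub>R x) = s * r x" if s: "0 \<le> s" for s x
  proof (cases "s = 0")
    case True
    have "r 0 \<le> 0"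
      using r_le[of 0 0] sublinear_zero[OF q] by simp
    moreover have "0 \<le> r 0"
      by (rule r_ge) (simp add: hom)
    ultimately show ?thesis
      using True by simp
  next
    case False
    with s have s': "0 < s" by simp
    have "r (inverse s *\<^sub>R (s *\<^sub>R x)) \<le> inverse s * r (s *\<^sub>R x)"
      using s' by (intro r_scale_le) simp
    then have "s * r x \<le> r (s *\<^sub>R x)"
      using s' by (simp add: field_simps)
    then show ?thesis
      using r_scale_le[OF s', of x] by simp
  qed
  with r_add show "sublinear r"
    unfolding sublinear_def by blast
qed

text \<open>
  The pointwise infimum works. The common majorant keeps it finite, since
  \<open>q x \<ge> - p (- x)\<close>, and it is subadditive because in a chain two functionals that nearly attain
  the infimum at \<open>x\<close> and at \<open>y\<close> can be replaced by the smaller of the two.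
\<close>

lemma sublinear_chain_lower_bound:
  fixes p :: "'a::real_vector \<Rightarrow> real"
  assumes C: "\<forall>q\<in>C. sublinear q \<and> q \<le> p"
    and chain: "\<forall>q\<in>C. \<forall>r\<in>C. q \<le> r \<or> r \<le> q" and ne: "C \<noteq> {}"
  obtains m where "sublinear m" and "\<forall>q\<in>C. m \<le> q"
proof
  have sub: "sublinear q" and le: "q x \<le> p x" if "q \<in> C" for q x
    using C that by (auto simp: le_fun_def)
  define m where "m x = (INF q\<in>C. q x)" for x
  have bdd: "bdd_below ((\<lambda>q. q x) ` C)" for x
    using sublinear_ge_neg_majorant[OF sub le] by (intro bdd_belowI[of _ "- p (- x)"]) auto
  have lower: "m x \<le> q x" if "q \<in> C" for q x
    unfolding m_def using that by (intro cINF_lower[OF bdd])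
  then show "\<forall>q\<in>C. m \<le> q"
    by (simp add: le_fun_def)
  have greatest: "c \<le> m x" if "\<And>q. q \<in> C \<Longrightarrow> c \<le> q x" for c x
    unfolding m_def using that ne by (intro cINF_greatest)
  have add: "m (x + y) \<le> m x + m y" for x y
  proof -
    have *: "m (x + y) \<le> q x + r y" if q: "q \<in> C" and r: "r \<in> C" for q r
    proof -
      obtain w where "w \<in> C" "w \<le> q" "w \<le> r"
        using chain q r by blast
      then have "m (x + y) \<le> w (x + y)" "w (x + y) \<le> w x + w y" "w x \<le> q x" "w y \<le> r y"
        using lower sub unfolding sublinear_def by (auto simp: le_fun_def)
      then show ?thesis by linarith
    qed
    have "m (x + y) - r y \<le> m x" if "r \<in> C" for r
      using *[OF _ that] by (intro greatest) (simp add: algebra_simps)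
    then have "m (x + y) - m x \<le> m y"
      by (intro greatest) (simp add: algebra_simps)
    then show ?thesis by simp
  qed
  have scale: "m (s *\<^sub>R x) = s * m x" if s: "0 \<le> s" for s x
  proof (cases "s = 0")
    case True
    have "(\<lambda>q. q 0) ` C = {0}"
      using ne sub by (auto simp: sublinear_zero)
    then show ?thesis
      using True by (simp add: m_def)
  next
    case False
    with s have s': "0 < s" by simp
    have hom: "q (s *\<^sub>R x) = s * q x" if "q \<in> C" for q
      using sub[OF that] s unfolding sublinear_def by blast
    have "s * m x \<le> m (s *\<^sub>R x)"
      using lower s by (intro greatest) (simp add: hom mult_left_mono)
    moreover have "m (s *\<^sub>R x) / s \<le> m x"
      using lower[of _ "s *\<^sub>R x"] s' by (intro greatest) (simp add: hom field_simps)
    ultimately show ?thesis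
      using s' by (simp add: field_simps)
  qed
  show "sublinear m"
    using add scale unfolding sublinear_def by blast
qed

text \<open>
  By Zorn's lemma there is a minimal sublinear functional below \<open>p\<close>; minimality makes it linear.
\<close>

lemma hahn_banach_sublinear:
  fixes p :: "'a::real_vector \<Rightarrow> real"
  assumes p: "sublinear p"
  obtains f where "linear f" and "\<And>x. f x \<le> p x"
proof -
  define S where "S = {q. sublinear q \<and> q \<le> p}"
  have "\<exists>f\<in>S. \<forall>q\<in>S. q \<le> f \<longrightarrow> q = f"
  proof (rule predicate_Zorn)
    show "partial_order_on S (relation_of (\<lambda>q r. r \<le> q) S)"
      by (rule partial_order_on_relation_ofI) auto
    fix C assume C: "C \<in> Chains (relation_of (\<lambda>q r. r \<le> q) S)"
    show "\<exists>u\<in>S. \<forall>a\<in>C. u \<le> a"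
    proof (cases "C = {}")
      case True
      then show ?thesis
        using p unfolding S_def by auto
    next
      case False
      have CS: "C \<subseteq> S" and chain: "\<forall>q\<in>C. \<forall>r\<in>C. q \<le> r \<or> r \<le> q"
        using C unfolding Chains_def relation_of_def by auto
      have "\<forall>q\<in>C. sublinear q \<and> q \<le> p"
        using CS unfolding S_def by blast
      then obtain m where m: "sublinear m" "\<forall>q\<in>C. m \<le> q"
        using chain False by (rule sublinear_chain_lower_bound)
      obtain q where "q \<in> C"
        using False by blast
      then have "m \<le> q" and "q \<le> p"
        using m(2) CS unfolding S_def by auto
      then have "m \<in> S"
        using m(1) order_trans unfolding S_def by blast
      with m(2) show ?thesis ..
    qed
  qed
  then obtain f where f: "f \<in> S" and minimal: "\<And>q. q \<in> S \<Longrightarrow> q \<le> f \<Longrightarrow> q = f"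
    by blast
  have sub: "sublinear f" and le: "f x \<le> p x" for x
    using f unfolding S_def by (auto simp: le_fun_def)
  have add: "f (x + v) = f x + f v" for x v
  proof -
    obtain r where r: "sublinear r" "\<And>x. r x \<le> f x" "\<And>x. r x \<le> f (x + v) - f v"
      using sublinear_lowering[OF sub] by blast
    have "r \<in> S"
      using r(1) order_trans[OF r(2) le] unfolding S_def by (simp add: le_fun_def)
    then have "r = f"
      using minimal r(2) by (simp add: le_fun_def)
    then have "f x + f v \<le> f (x + v)"
      using r(3)[of x] by simp
    then show ?thesis
      using sub unfolding sublinear_def by (simp add: order_antisym)
  qed
  have neg: "f (- x) = - f x" for x
    using add[of x "- x"] sublinear_zero[OF sub] by simp
  have nonneg: "f (t *\<^sub>R x) = t * f x" if "0 \<le> t" for t x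
    using sub that unfolding sublinear_def by blast
  have "f (t *\<^sub>R x) = t * f x" for t x
  proof (cases "0 \<le> t")
    case False
    then show ?thesis
      using nonneg[of "- t" x] neg[of "t *\<^sub>R x"] by simp
  qed (rule nonneg)
  then have "linear f"
    by (intro linearI) (simp_all add: add)
  with le show thesis
    using that by blast
qed

text \<open>
  Lowering the norm in the direction \<open>y\<close> before taking a linear minorant forces the value at
  \<open>y\<close>: the lowered functional at \<open>- y\<close> is at most \<open>norm 0 - norm y\<close>.
\<close>

lemma real_norming_functional:
  fixes y :: "'a::real_normed_vector"
  obtains f where "linear f" and "\<And>x. \<bar>f x\<bar> \<le> norm x" and "f y = norm y"
proof -
  have "sublinear (norm :: 'a \<Rightarrow> real)"
    unfolding sublinear_def by (auto simp: norm_triangle_ineq)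
  then obtain r where r: "sublinear r" "\<And>x. r x \<le> norm x" "\<And>x. r x \<le> norm (x + y) - norm y"
    using sublinear_lowering by blast
  obtain f where f: "linear f" "\<And>x. f x \<le> r x"
    using hahn_banach_sublinear[OF r(1)] by blast
  have le: "f x \<le> norm x" for x
    using f(2) r(2) by (rule order_trans)
  have neg: "f (- x) = - f x" for x
    using linear_neg[OF f(1)] .
  have "\<bar>f x\<bar> \<le> norm x" for x
    using le[of x] le[of "- x"] neg by (simp add: abs_le_iff)
  moreover have "f y = norm y"
    using f(2)[of "- y"] r(3)[of "- y"] le[of y] neg by (simp add: order_antisym)
  ultimately show thesis
    using that f(1) by blast
qed

section \<open>Functionals on real and complex Banach spaces\<close>

lemma real_linear_continuous_imp_bounded:
  fixes f :: "'a::real_normed_vector \<Rightarrow> 'b::real_normed_vector"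
  assumes lin: "linear f" and cont: "continuous_on UNIV f"
  shows "bounded_linear f"
proof -
  obtain d where d: "0 < d" "\<And>x. norm x < d \<Longrightarrow> norm (f x) < 1"
  proof -
    have "\<exists>d>0. \<forall>x. dist x 0 < d \<longrightarrow> dist (f x) (f 0) < 1"
      using cont unfolding continuous_on_iff by (metis UNIV_I zero_less_one)
    then show thesis
      using that linear_0[OF lin] by auto
  qed
  have "norm (f x) \<le> norm x * (2 / d)" for x
  proof (cases "x = 0")
    case True
    then show ?thesis
      using linear_0[OF lin] by simp
  next
    case False
    have "norm (f ((d / (2 * norm x)) *\<^sub>R x)) < 1"
      using False d(1) by (intro d(2)) simp
    then show ?thesis
      using False d(1) by (simp add: linear_scale[OF lin] field_simps)
  qed
  then show ?thesis
    using lin by (intro bounded_linear_intro[where K = "2 / d"]) (simp_all add: linear_add linear_scale)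
qed

lemma vector_space_field: "vector_space ((*) :: 'k::field \<Rightarrow> 'k \<Rightarrow> 'k)"
  by unfold_locales (simp_all add: algebra_simps)

context banach_space
begin

lemma linear_dual_iff:
  "Vector_Spaces.linear scale (*) f \<longleftrightarrow>
     (\<forall>x y. f (x + y) = f x + f y) \<and> (\<forall>c x. f (scale c x) = c * f x)"
  by (simp add: Vector_Spaces.linear_iff vector_space_axioms vector_space_field)

lemma dual_space_bounded_linear:
  assumes "f \<in> dual_space scale"
  shows "bounded_linear f"
proof (rule real_linear_continuous_imp_bounded)
  have f: "f (x + y) = f x + f y" "f (scale c x) = c * f x" for x y c
    using assms unfolding dual_space_def linear_dual_iff by auto
  show "linear f"
    using f(2)[of "of_real _"] by (intro linearI) (simp_all add: f(1) scale_of_real scaleR_conv_of_real)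
  show "continuous_on UNIV f"
    using assms unfolding dual_space_def by auto
qed

text \<open>
  The form in which membership in the dual ball is used below; continuity is implied by the norm bound.
\<close>

lemma dual_ball_iff:
  "f \<in> dual_ball scale \<longleftrightarrow>
     (\<forall>x y. f (x + y) = f x + f y) \<and> (\<forall>c x. f (scale c x) = c * f x) \<and> (\<forall>x. norm (f x) \<le> norm x)"
  (is "?lhs \<longleftrightarrow> ?rhs")
proof
  assume lhs: ?lhs
  then have dual: "f \<in> dual_space scale" and "onorm f \<le> 1"
    unfolding dual_ball_def by auto
  have "norm (f x) \<le> norm x" for x
    using onorm[OF dual_space_bounded_linear[OF dual], of x] \<open>onorm f \<le> 1\<close>
    by (meson mult_left_le_one_le norm_ge_zero onorm_pos_le[OF dual_space_bounded_linear[OF dual]] order_trans)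
  with dual show ?rhs
    unfolding dual_space_def linear_dual_iff by blast
next
  assume rhs: ?rhs
  have "bounded_linear f"
  proof (rule bounded_linear_intro)
    show "f (x + y) = f x + f y" for x y using rhs by blast
    show "f (r *\<^sub>R x) = r *\<^sub>R f x" for r x
      using rhs by (metis scale_of_real scaleR_conv_of_real)
    show "norm (f x) \<le> norm x * 1" for x using rhs by simp
  qed
  then show ?lhs
    using rhs unfolding dual_ball_def dual_space_def linear_dual_iff
    by (auto intro: onorm_bound linear_continuous_on)
qed

end

text \<open>
  Transports the isomorphism with \<open>real\<close> or \<open>complex\<close> into the scalar field itself, so that
  scalars can be handled without it; \<open>J\<close> is the imaginary unit.
\<close>

lemma real_or_complex_cases:
  obtains (real) "\<And>c :: 'k::real_or_complex. \<exists>a. c = of_real a"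
    | (complex) J :: "'k::real_or_complex" where "J * J = - 1" "\<And>c. \<exists>a b. c = of_real a + of_real b * J"
        "\<And>a b. norm (of_real a + of_real b * J) = sqrt (a\<^sup>2 + b\<^sup>2)"
  using real_or_complex
proof (elim disjE exE conjE)
  fix h :: "'k \<Rightarrow> real"
  assume h: "bij h" "\<forall>a b. h (a + b) = h a + h b" "\<forall>a b. h (a * b) = h a * h b"
    "\<forall>r a. h (r *\<^sub>R a) = r *\<^sub>R h a" "\<forall>a. norm (h a) = norm a"
  have "h 1 \<noteq> 0"
    using h(5) by (metis norm_eq_zero zero_neq_one)
  have "c = of_real (h c / h 1)" for c
  proof -
    have "h (of_real (h c / h 1)) = h c"
      using h(4) \<open>h 1 \<noteq> 0\<close> by (simp add: of_real_def)
    then show ?thesis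
      using h(1) by (metis bij_pointE)
  qed
  then show thesis
    by (intro real) blast
next
  fix h :: "'k \<Rightarrow> complex"
  assume h: "bij h" "\<forall>a b. h (a + b) = h a + h b" "\<forall>a b. h (a * b) = h a * h b"
    "\<forall>r a. h (r *\<^sub>R a) = r *\<^sub>R h a" "\<forall>a. norm (h a) = norm a"
  have inj: "a = b" if "h a = h b" for a b
    using h(1) that by (metis bij_pointE)
  have "h 1 \<noteq> 0"
    using h(5) by (metis norm_eq_zero zero_neq_one)
  moreover have "h 1 * h 1 = h 1"
    using h(3) by (metis mult_1)
  ultimately have h1: "h 1 = 1"
    by simp
  have hr: "h (of_real r) = of_real r" for r
    using h(4) h1 by (simp add: of_real_def)
  obtain J where J: "h J = \<i>"
    using h(1) by (metis bij_pointE)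
  have hab: "h (of_real a + of_real b * J) = Complex a b" for a b
    using h(2,3) by (simp add: hr J complex_eq_iff)
  show thesis
  proof (rule complex)
    have "h (J * J) = h (of_real (- 1))"
      using h(3) by (simp only: hr J) simp
    then show "J * J = - 1"
      using inj by fastforce
    show "\<exists>a b. c = of_real a + of_real b * J" for c
      using inj[of c "of_real (Re (h c)) + of_real (Im (h c)) * J"] hab by auto
    show "norm (of_real a + of_real b * J) = sqrt (a\<^sup>2 + b\<^sup>2)" for a b
      using h(5) hab by (metis cmod_def complex.sel)
  qed
qed

text \<open>
  Over the complex scalars, a real functional \<open>g\<close> is the real part of exactly one complex-linear
  one, namely \<open>g x - g (J x) J\<close>. Its norm does not exceed that of \<open>g\<close>: rotate \<open>x\<close> by a
  unimodular \<open>u\<close> so that the value at \<open>u x\<close> is real, hence equal to \<open>g (u x)\<close>.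
\<close>

lemma (in banach_space) norming_functional:
  obtains f where "f \<in> dual_ball scale" and "norm (f y) = norm y"
proof -
  obtain g where g: "linear g" "\<And>x. \<bar>g x\<bar> \<le> norm x" "g y = norm y"
    using real_norming_functional by blast
  note g_add = linear_add[OF g(1)] and g_scale = linear_scale[OF g(1)]
  show thesis
  proof (cases rule: real_or_complex_cases[where ?'k = 'k])
    case real
    show thesis
    proof
      have "of_real (g (scale c x)) = c * of_real (g x)" for c :: 'k and x
        using real[of c] by (auto simp: scale_of_real g_scale)
      then show "(\<lambda>x. of_real (g x)) \<in> dual_ball scale"
        unfolding dual_ball_iff using g(2) by (simp add: g_add)
      show "norm (of_real (g y) :: 'k) = norm y"
        using g(3) by simp
    qed
  next
    case (complex J)
    define f where "f x = of_real (g x) - of_real (g (scale J x)) * J" for x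
    have f_norm: "norm (f x) = sqrt ((g x)\<^sup>2 + (g (scale J x))\<^sup>2)" for x
      using complex(3)[of "g x" "- g (scale J x)"] unfolding f_def by simp
    have f_add: "f (x + z) = f x + f z" for x z
      unfolding f_def by (simp add: scale_right_distrib g_add algebra_simps)
    have f_real: "f (scale (of_real a) x) = of_real a * f x" for a x
    proof -
      have "scale J (scale (of_real a) x) = a *\<^sub>R scale J x"
        by (metis scale_of_real scale_left_commute)
      then show ?thesis
        unfolding f_def by (simp add: scale_of_real g_scale algebra_simps)
    qed
    have f_J: "f (scale J x) = J * f x" for x
    proof -
      have "scale J (scale J x) = - x"
        by (simp add: complex(1))
      moreover have "J * (of_real t * J) = - of_real t" for t
        using complex(1) by (metis mult.left_commute mult.right_neutral mult_minus_right)
      ultimately show ?thesis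
        unfolding f_def by (simp add: linear_neg[OF g(1)] right_diff_distrib mult.commute)
    qed
    have f_scale: "f (scale c x) = c * f x" for c x
    proof -
      obtain a b where c: "c = of_real a + of_real b * J"
        using complex(2) by blast
      have "f (scale c x) = f (scale (of_real a) x) + f (scale (of_real b) (scale J x))"
        unfolding c by (simp add: scale_left_distrib f_add)
      then show ?thesis
        unfolding c f_real f_J by (simp add: distrib_right mult.assoc)
    qed
    have f_le: "norm (f x) \<le> norm x" for x
    proof (cases "f x = 0")
      case False
      define u where "u = of_real (norm (f x)) / f x"
      have "norm u = 1" and fu: "f (scale u x) = of_real (norm (f x))"
        using False unfolding u_def by (simp_all add: norm_divide f_scale)
      \<comment> \<open>compare real parts through the formula for the norm\<close>
      have "of_real (g (scale u x) - norm (f x)) + of_real (- g (scale J (scale u x))) * J = 0"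
        using fu unfolding f_def by (simp add: algebra_simps)
      then have "sqrt ((g (scale u x) - norm (f x))\<^sup>2 + (- g (scale J (scale u x)))\<^sup>2) = 0"
        using complex(3) by (metis norm_zero)
      then have "g (scale u x) = norm (f x)"
        by (simp add: sum_power2_eq_zero_iff)
      then show ?thesis
        using g(2)[of "scale u x"] \<open>norm u = 1\<close> by (simp add: norm_scale)
    qed simp
    show thesis
    proof
      show "f \<in> dual_ball scale"
        unfolding dual_ball_iff using f_add f_scale f_le by blast
      have "norm y \<le> norm (f y)"
        unfolding f_norm using g(3) by (intro real_le_rsqrt) simp
      then show "norm (f y) = norm y"
        using f_le by (simp add: order_antisym)
    qed
  qed
qed

section \<open>Duality of finite \<open>\<ell>\<^sub>p\<close> sums\<close>

text \<open>
  The point \<open>0\<close> has to be included because some of the scalars in the Hoelder estimate may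
  vanish.
\<close>

lemma convex_on_powr:
  fixes q :: real
  assumes q: "1 \<le> q"
  shows "convex_on {0..} (\<lambda>x. x powr q)"
proof (rule convex_onI)
  fix t x y :: real
  assume t: "0 < t" "t < 1" and xy: "x \<in> {0..}" "y \<in> {0..}"
  have shrink: "(s * u) powr q \<le> s * u powr q" if "0 < s" "s < 1" "0 \<le> u" for s u :: real
  proof -
    have "s powr q \<le> s powr 1"
      using that q by (intro powr_mono') auto
    then show ?thesis
      using that by (simp add: powr_mult mult_right_mono)
  qed
  consider "x = 0" | "y = 0" | "0 < x" "0 < y"
    using xy by force
  then show "((1 - t) *\<^sub>R x + t *\<^sub>R y) powr q \<le> (1 - t) * x powr q + t * y powr q"
  proof cases
    case 1
    then show ?thesis
      using shrink[of t y] t xy q by simp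
  next
    case 2
    then show ?thesis
      using shrink[of "1 - t" x] t xy q by simp
  next
    case 3
    then show ?thesis
      using convex_onD[OF powr_convex[OF q], of t x y] t by simp
  qed
qed simp

text \<open>
  The extremal case of Hoelder's inequality: the coefficients attain the \<open>\<ell>\<^sub>q\<close>-norm of \<open>b\<close>
  and act contractively on \<open>\<ell>\<^sub>q\<close>. Up to normalisation \<open>a\<^sub>n = \<bar>b\<^sub>n\<bar>\<^sup>q / b\<^sub>n\<close>, which is \<open>0\<close> where
  \<open>b\<^sub>n = 0\<close>. The contractive bound is Jensen's inequality for \<open>x \<mapsto> x\<^sup>q\<close> with the weights
  \<open>\<bar>b\<^sub>n\<bar>\<^sup>q / S\<close>; this avoids the conjugate exponent, so \<open>q = 1\<close> is no exception.
\<close>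

lemma holder_dual_coefficients:
  fixes b :: "'i \<Rightarrow> 'k::real_normed_field" and q :: real
  assumes q: "1 \<le> q" and A: "finite A" and pos: "0 < (\<Sum>n\<in>A. norm (b n) powr q)"
  obtains a where "(\<Sum>n\<in>A. a n * b n) = of_real ((\<Sum>n\<in>A. norm (b n) powr q) powr (1 / q))"
    and "\<forall>c. norm (\<Sum>n\<in>A. a n * c n) powr q \<le> (\<Sum>n\<in>A. norm (c n) powr q)"
proof
  define S where "S = (\<Sum>n\<in>A. norm (b n) powr q)"
  define w where "w n = norm (b n) powr q / S" for n
  define a where "a n = of_real (S powr (1 / q) * w n) / b n" for n
  have S: "0 < S"
    using pos unfolding S_def .
  have w: "0 \<le> w n" for n
    using S unfolding w_def by simp
  have w_sum: "(\<Sum>n\<in>A. w n) = 1"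
    using S unfolding w_def by (simp add: S_def flip: sum_divide_distrib)
  have "a n * b n = of_real (S powr (1 / q) * w n)" for n
    unfolding a_def w_def by (cases "b n = 0") auto
  then have "(\<Sum>n\<in>A. a n * b n) = of_real (S powr (1 / q) * (\<Sum>n\<in>A. w n))"
    by (simp add: sum_distrib_left)
  then show "(\<Sum>n\<in>A. a n * b n) = of_real (S powr (1 / q))"
    using w_sum by simp
  show "\<forall>c. norm (\<Sum>n\<in>A. a n * c n) powr q \<le> (\<Sum>n\<in>A. norm (c n) powr q)"
  proof
    fix c :: "'i \<Rightarrow> 'k"
    define t where "t n = S powr (1 / q) * norm (c n) / norm (b n)" for n
    have "A \<noteq> {}"
      using pos by auto
    have "norm (\<Sum>n\<in>A. a n * c n) \<le> (\<Sum>n\<in>A. norm (a n * c n))"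
      by (rule norm_sum)
    also have "\<dots> = (\<Sum>n\<in>A. w n *\<^sub>R t n)"
      using w S by (intro sum.cong refl) (simp add: a_def t_def norm_mult norm_divide)
    finally have "norm (\<Sum>n\<in>A. a n * c n) powr q \<le> (\<Sum>n\<in>A. w n *\<^sub>R t n) powr q"
      using q by (intro powr_mono2) auto
    also have "\<dots> \<le> (\<Sum>n\<in>A. w n * t n powr q)"
      using w w_sum S by (intro convex_on_sum[OF A \<open>A \<noteq> {}\<close> convex_on_powr[OF q]]) (auto simp: t_def)
    also have "\<dots> \<le> (\<Sum>n\<in>A. norm (c n) powr q)"
    proof (rule sum_mono)
      fix n
      show "w n * t n powr q \<le> norm (c n) powr q"
        using S q by (cases "b n = 0") (simp_all add: w_def t_def powr_mult powr_divide powr_powr)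
    qed
    finally show "norm (\<Sum>n\<in>A. a n * c n) powr q \<le> (\<Sum>n\<in>A. norm (c n) powr q)" .
  qed
qed

section \<open>Summability through finite sums\<close>

lemma ennreal_suminf_le_iff:
  fixes g :: "nat \<Rightarrow> real"
  assumes g: "\<And>n. 0 \<le> g n" and K: "0 \<le> K"
  shows "(\<Sum>n. ennreal (g n)) \<le> ennreal K \<longleftrightarrow> (\<forall>A. finite A \<longrightarrow> sum g A \<le> K)"
proof -
  have "(\<Sum>n. ennreal (g n)) \<le> ennreal K \<longleftrightarrow> (\<forall>N. sum g {..<N} \<le> K)"
    using g K by (simp add: suminf_eq_SUP SUP_le_iff sum_ennreal)
  also have "\<dots> \<longleftrightarrow> (\<forall>A. finite A \<longrightarrow> sum g A \<le> K)"
  proof (intro iffI allI impI)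
    fix A :: "nat set" assume *: "\<forall>N. sum g {..<N} \<le> K" and "finite A"
    then obtain N where "A \<subseteq> {..<N}"
      using finite_nat_iff_bounded by blast
    then have "sum g A \<le> sum g {..<N}"
      using g by (intro sum_mono2) auto
    then show "sum g A \<le> K"
      using * order_trans by blast
  qed simp
  finally show ?thesis .
qed

lemma ennreal_powr_inverse_le_iff:
  assumes q: "0 < q" and C: "0 \<le> C"
  shows "ennreal_powr c (1 / q) \<le> ennreal C \<longleftrightarrow> c \<le> ennreal (C powr q)"
proof (cases c)
  case (real r)
  have "r powr (1 / q) \<le> C \<longleftrightarrow> r \<le> C powr q"
  proof
    assume "r powr (1 / q) \<le> C"
    then have "(r powr (1 / q)) powr q \<le> C powr q"
      using q by (intro powr_mono2) auto
    then show "r \<le> C powr q"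
      using q real by (simp add: powr_powr)
  next
    assume "r \<le> C powr q"
    then have "r powr (1 / q) \<le> (C powr q) powr (1 / q)"
      using q real by (intro powr_mono2) auto
    then show "r powr (1 / q) \<le> C"
      using q C by (simp add: powr_powr)
  qed
  then show ?thesis
    using real C unfolding ennreal_powr_def by simp
qed (simp add: ennreal_powr_def top_unique)

text \<open>
  Bounds on finite partial sums replace the series in \<open>[0,\<infinity>]\<close> and its root. From here on
  \<open>weak_tail\<close> is used only through the resulting criteria for summability.
\<close>

lemma weak_tail_le_iff:
  assumes q: "0 < q" and C: "0 \<le> C"
  shows "weak_tail s q x m \<le> ennreal C \<longleftrightarrow>
    (\<forall>f\<in>dual_ball s. \<forall>A. finite A \<longrightarrow> A \<subseteq> {m..} \<longrightarrow> (\<Sum>n\<in>A. norm (f (x n)) powr q) \<le> C powr q)"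
proof -
  have shift: "(\<forall>A. finite A \<longrightarrow> (\<Sum>n\<in>A. g (m + n)) \<le> K) \<longleftrightarrow>
      (\<forall>A. finite A \<longrightarrow> A \<subseteq> {m..} \<longrightarrow> sum g A \<le> K)" (is "?L \<longleftrightarrow> ?R") for g :: "nat \<Rightarrow> real" and K
  proof
    assume ?R
    show ?L
    proof (intro allI impI)
      fix A :: "nat set" assume "finite A"
      then have "sum g ((+) m ` A) \<le> K"
        using \<open>?R\<close>[rule_format, of "(+) m ` A"] by (simp add: image_subset_iff)
      then show "(\<Sum>n\<in>A. g (m + n)) \<le> K"
        by (simp add: sum.reindex)
    qed
  next
    assume ?L
    show ?R
    proof (intro allI impI)
      fix A :: "nat set" assume "finite A" and A: "A \<subseteq> {m..}"
      then have "(\<Sum>n\<in>(\<lambda>n. n - m) ` A. g (m + n)) \<le> K"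
        using \<open>?L\<close>[rule_format, of "(\<lambda>n. n - m) ` A"] by simp
      moreover have "(\<Sum>n\<in>(\<lambda>n. n - m) ` A. g (m + n)) = sum g A"
        using A by (subst sum.reindex[OF inj_on_diff_nat]) (auto intro!: sum.cong)
      ultimately show "sum g A \<le> K"
        by simp
    qed
  qed
  show ?thesis
    unfolding weak_tail_def SUP_le_iff ennreal_powr_inverse_le_iff[OF q C]
    by (simp only: ennreal_suminf_le_iff[OF powr_ge_zero powr_ge_zero] shift[of "\<lambda>n. norm (_ (x n)) powr q"])
qed

lemma weakly_summable_finite_iff:
  assumes p: "1 \<le> p" "p \<noteq> \<infinity>"
  shows "weakly_summable s p x \<longleftrightarrow>
    (\<exists>C. \<forall>f\<in>dual_ball s. \<forall>A. finite A \<longrightarrow> (\<Sum>n\<in>A. norm (f (x n)) powr enn2real p) \<le> C)"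
    (is "_ \<longleftrightarrow> (\<exists>C. ?bd C)")
proof -
  define q where "q = enn2real p"
  have q: "0 < q"
    using p unfolding q_def by (cases p) auto
  have "weakly_summable s p x \<longleftrightarrow> (\<exists>C\<ge>0. weak_tail s q x 0 \<le> ennreal C)"
    unfolding weakly_summable_def q_def[symmetric] using p(2)
    by (cases "weak_tail s q x 0") (auto simp: top_unique)
  also have "\<dots> \<longleftrightarrow> (\<exists>C\<ge>0. ?bd (C powr q))"
    using q unfolding q_def[symmetric] by (auto simp: weak_tail_le_iff)
  also have "\<dots> \<longleftrightarrow> (\<exists>C. ?bd C)"
  proof
    assume "\<exists>C. ?bd C"
    then obtain C where C: "?bd C" by blast
    then have "?bd (max C 0)"
      by (meson max.cobounded1 order_trans)
    moreover have "((max C 0) powr (1 / q)) powr q = max C 0"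
      using q by (simp add: powr_powr)
    ultimately show "\<exists>C\<ge>0. ?bd (C powr q)"
      by (intro exI[of _ "max C 0 powr (1 / q)"]) simp
  qed blast
  finally show ?thesis .
qed

lemma weak_tail_tendsto_zero_iff:
  assumes q: "0 < q"
  shows "weak_tail s q x \<longlonglongrightarrow> 0 \<longleftrightarrow>
    (\<forall>e>0. \<exists>m. \<forall>f\<in>dual_ball s. \<forall>A. finite A \<longrightarrow> A \<subseteq> {m..} \<longrightarrow>
       (\<Sum>n\<in>A. norm (f (x n)) powr q) \<le> e powr q)"
    (is "_ \<longleftrightarrow> (\<forall>e>0. \<exists>m. ?bd e m)")
proof
  assume lim: "weak_tail s q x \<longlonglongrightarrow> 0"
  show "\<forall>e>0. \<exists>m. ?bd e m"
  proof (intro allI impI)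
    fix e :: real assume e: "0 < e"
    then have "eventually (\<lambda>m. weak_tail s q x m < ennreal e) sequentially"
      by (intro order_tendstoD[OF lim]) simp
    then obtain m where "weak_tail s q x m \<le> ennreal e"
      by (auto simp: eventually_sequentially intro: less_imp_le)
    then show "\<exists>m. ?bd e m"
      using e q by (auto simp: weak_tail_le_iff)
  qed
next
  assume bd: "\<forall>e>0. \<exists>m. ?bd e m"
  show "weak_tail s q x \<longlonglongrightarrow> 0"
  proof (rule order_tendstoI)
    fix a :: ennreal assume "0 < a"
    then obtain b where b: "0 < b" "b < a"
      using dense by blast
    then obtain e where e: "b = ennreal e" "0 < e"
      by (cases b) auto
    then obtain m where "?bd e m"
      using bd by blast
    then have "?bd e k" if "m \<le> k" for k
      using that by (meson atLeast_subset_iff order_trans)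
    then have "weak_tail s q x k \<le> ennreal e" if "m \<le> k" for k
      using e q that by (subst weak_tail_le_iff) auto
    then show "eventually (\<lambda>m. weak_tail s q x m < a) sequentially"
      using b e unfolding eventually_sequentially by (auto intro: le_less_trans)
  qed simp
qed

section \<open>Weakly \<open>p\<close>-summable sequences\<close>

lemma enn2real_ge_one:
  assumes "1 \<le> p" "p \<noteq> \<infinity>"
  shows "1 \<le> enn2real p"
  using assms by (cases p) auto

lemma weakly_summable_subseq:
  assumes p: "1 \<le> p" and x: "weakly_summable s p x" and k: "strict_mono k"
  shows "weakly_summable s p (\<lambda>n. x (k n))"
proof (cases "p = \<infinity>")
  case True
  then show ?thesis
    using x LIMSEQ_subseq_LIMSEQ[OF _ k] unfolding weakly_summable_def by (force simp: o_def)
next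
  case False
  then obtain C where C: "\<forall>f\<in>dual_ball s. \<forall>A. finite A \<longrightarrow> (\<Sum>n\<in>A. norm (f (x n)) powr enn2real p) \<le> C"
    using x p by (auto simp: weakly_summable_finite_iff)
  have inj: "inj_on k A" for A
    using strict_mono_imp_inj_on[OF k] subset_UNIV by (rule inj_on_subset)
  have "(\<Sum>n\<in>A. norm (f (x (k n))) powr enn2real p) \<le> C" if "f \<in> dual_ball s" "finite A" for f A
    using C[rule_format, of f "k ` A"] that by (simp add: sum.reindex[OF inj])
  then show ?thesis
    using p False by (auto simp: weakly_summable_finite_iff)
qed

lemma (in banach_space) weakly_summable_diff:
  assumes p: "1 \<le> p" and x: "weakly_summable scale p x" and y: "weakly_summable scale p y"
  shows "weakly_summable scale p (\<lambda>n. x n - y n)"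
proof (cases "p = \<infinity>")
  case True
  have "(\<lambda>n. f (x n - y n)) \<longlonglongrightarrow> 0" if f: "f \<in> dual_space scale" for f
  proof -
    have "f (x n - y n) = f (x n) - f (y n)" for n
      using linear_diff[OF bounded_linear.linear[OF dual_space_bounded_linear[OF f]]] .
    moreover have "(\<lambda>n. f (x n) - f (y n)) \<longlonglongrightarrow> 0 - 0"
      using True x y f unfolding weakly_summable_def by (intro tendsto_diff) auto
    ultimately show ?thesis
      by simp
  qed
  then show ?thesis
    using True unfolding weakly_summable_def by simp
next
  case False
  define q where "q = enn2real p"
  have q: "1 \<le> q"
    using enn2real_ge_one[OF p False] unfolding q_def .
  obtain C where C: "\<forall>f\<in>dual_ball scale. \<forall>A. finite A \<longrightarrow> (\<Sum>n\<in>A. norm (f (x n)) powr q) \<le> C"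
    using x p False unfolding q_def by (auto simp: weakly_summable_finite_iff)
  obtain D where D: "\<forall>f\<in>dual_ball scale. \<forall>A. finite A \<longrightarrow> (\<Sum>n\<in>A. norm (f (y n)) powr q) \<le> D"
    using y p False unfolding q_def by (auto simp: weakly_summable_finite_iff)
  have pointwise: "norm (a - b) powr q \<le> 2 powr q * (norm a powr q + norm b powr q)" for a b :: 'k
  proof -
    have "norm (a - b) powr q \<le> (2 * max (norm a) (norm b)) powr q"
      using norm_triangle_ineq4[of a b] q by (intro powr_mono2) auto
    also have "\<dots> = 2 powr q * max (norm a) (norm b) powr q"
      by (rule powr_mult)
    also have "max (norm a) (norm b) powr q \<le> norm a powr q + norm b powr q"
      by (simp add: max_def)
    finally show ?thesis
      by simp
  qed
  have "(\<Sum>n\<in>A. norm (f (x n - y n)) powr q) \<le> 2 powr q * (C + D)"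
    if f: "f \<in> dual_ball scale" and A: "finite A" for f A
  proof -
    have "f \<in> dual_space scale"
      using f unfolding dual_ball_def by blast
    then have diff: "f (a - b) = f a - f b" for a b
      using linear_diff bounded_linear.linear dual_space_bounded_linear by blast
    have "(\<Sum>n\<in>A. norm (f (x n - y n)) powr q)
        \<le> (\<Sum>n\<in>A. 2 powr q * (norm (f (x n)) powr q + norm (f (y n)) powr q))"
      unfolding diff by (intro sum_mono pointwise)
    also have "\<dots> = 2 powr q * ((\<Sum>n\<in>A. norm (f (x n)) powr q) + (\<Sum>n\<in>A. norm (f (y n)) powr q))"
      by (simp add: sum.distrib flip: sum_distrib_left)
    also have "\<dots> \<le> 2 powr q * (C + D)"
      using C D f A by (intro mult_left_mono add_mono) auto
    finally show ?thesis .
  qed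
  then show ?thesis
    using p False unfolding q_def by (auto simp: weakly_summable_finite_iff)
qed

lemma weakly_summable_imp_weakly_null:
  assumes p: "1 \<le> p" and x: "weakly_summable s p x" and f: "f \<in> dual_ball s"
  shows "(\<lambda>n. f (x n)) \<longlonglongrightarrow> 0"
proof (cases "p = \<infinity>")
  case True
  then show ?thesis
    using x f unfolding weakly_summable_def dual_ball_def by auto
next
  case False
  define q where "q = enn2real p"
  have q: "0 < q"
    using enn2real_ge_one[OF p False] unfolding q_def by simp
  obtain C where C: "\<And>A. finite A \<Longrightarrow> (\<Sum>n\<in>A. norm (f (x n)) powr q) \<le> C"
    using x f p False unfolding q_def by (auto simp: weakly_summable_finite_iff)
  have "summable (\<lambda>n. norm (f (x n)) powr q)"
    by (rule summableI_nonneg_bounded) (use C in auto)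
  then have "(\<lambda>n. (norm (f (x n)) powr q) powr (1 / q)) \<longlonglongrightarrow> 0"
    by (rule tendsto_zero_powrI[OF summable_LIMSEQ_zero tendsto_const]) (use q in auto)
  then have "(\<lambda>n. norm (f (x n))) \<longlonglongrightarrow> 0"
    using q by (simp add: powr_powr)
  then show ?thesis
    by (rule tendsto_norm_zero_cancel)
qed

text \<open>
  Blocks of coefficients that are contractive for the \<open>\<ell>\<^sub>p\<close>-norm: each block takes from
  \<open>\<Sum> \<bar>f(x\<^sub>n)\<bar>\<^sup>p\<close> only its own disjoint part, so the bound for \<open>x\<close> is inherited.
\<close>

lemma weakly_summable_blocks:
  fixes a :: "nat \<Rightarrow> nat \<Rightarrow> 'k::real_or_complex"
  assumes s: "banach_space s" and p: "1 \<le> p" "p \<noteq> \<infinity>" and x: "weakly_summable s p x"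
    and fin: "\<And>i. finite (A i)" and disj: "disjoint_family A"
    and a: "\<And>i c. norm (\<Sum>n\<in>A i. a i n * c n) powr enn2real p \<le> (\<Sum>n\<in>A i. norm (c n) powr enn2real p)"
  shows "weakly_summable s p (\<lambda>i. \<Sum>n\<in>A i. s (a i n) (x n))"
proof -
  define q where "q = enn2real p"
  obtain C where C: "\<forall>f\<in>dual_ball s. \<forall>A. finite A \<longrightarrow> (\<Sum>n\<in>A. norm (f (x n)) powr q) \<le> C"
    using x p unfolding q_def by (auto simp: weakly_summable_finite_iff)
  have "(\<Sum>i\<in>I. norm (f (\<Sum>n\<in>A i. s (a i n) (x n))) powr q) \<le> C"
    if f: "f \<in> dual_ball s" and I: "finite I" for f I
  proof -
    have "f \<in> dual_space s"
      using f unfolding dual_ball_def by blast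
    then have "f (\<Sum>n\<in>A i. s (a i n) (x n)) = (\<Sum>n\<in>A i. f (s (a i n) (x n)))" for i
      using linear_sum bounded_linear.linear banach_space.dual_space_bounded_linear[OF s] by blast
    then have f_sum: "f (\<Sum>n\<in>A i. s (a i n) (x n)) = (\<Sum>n\<in>A i. a i n * f (x n))" for i
      using f by (simp add: banach_space.dual_ball_iff[OF s])
    have "(\<Sum>i\<in>I. norm (f (\<Sum>n\<in>A i. s (a i n) (x n))) powr q)
        \<le> (\<Sum>i\<in>I. \<Sum>n\<in>A i. norm (f (x n)) powr q)"
      unfolding f_sum q_def by (intro sum_mono a)
    also have "\<dots> = (\<Sum>n\<in>(\<Union>i\<in>I. A i). norm (f (x n)) powr q)"
      using I fin disj by (intro sum.UNION_disjoint[symmetric]) (auto simp: disjoint_family_on_def)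
    also have "\<dots> \<le> C"
      using I fin by (intro C[rule_format, OF f] finite_UN_I)
    finally show ?thesis .
  qed
  then show ?thesis
    using p unfolding q_def by (auto simp: weakly_summable_finite_iff)
qed

lemma operator_bounded_linear:
  assumes sX: "banach_space sX" and sY: "banach_space sY" and T: "operator_between sX sY T"
  shows "bounded_linear T"
proof (rule real_linear_continuous_imp_bounded)
  have T': "T (x + y) = T x + T y" "T (sX c x) = sY c (T x)" for x y c
    using T unfolding operator_between_def Vector_Spaces.linear_iff by auto
  show "linear T"
    using T'(2)[of "of_real _"]
    by (intro linearI)
      (simp_all add: T'(1) banach_space.scale_of_real[OF sX] banach_space.scale_of_real[OF sY])
  show "continuous_on UNIV T"
    using T unfolding operator_between_def by blast
qed

lemma dual_space_compose:
  assumes sX: "banach_space sX" and sY: "banach_space sY" and T: "operator_between sX sY T"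
    and f: "f \<in> dual_space sY"
  shows "(\<lambda>x. f (T x)) \<in> dual_space sX"
proof -
  have "T (x + y) = T x + T y" "T (sX c x) = sY c (T x)" for x y c
    using T unfolding operator_between_def Vector_Spaces.linear_iff by auto
  moreover have "f (x + y) = f x + f y" "f (sY c x) = c * f x" for x y c
    using f banach_space.linear_dual_iff[OF sY] unfolding dual_space_def by auto
  moreover have "continuous_on UNIV (\<lambda>x. f (T x))"
    using T f unfolding operator_between_def dual_space_def
    by (auto intro: continuous_on_compose2)
  ultimately show ?thesis
    unfolding dual_space_def by (simp add: banach_space.linear_dual_iff[OF sX])
qed

text \<open>
  For finite \<open>p\<close>: composition with \<open>T\<close> maps functionals of the dual ball of \<open>Y\<close> into a multiple \<open>M\<close> of the
  dual ball of \<open>X\<close>.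
\<close>

lemma weakly_summable_image:
  assumes sX: "banach_space sX" and sY: "banach_space sY" and T: "operator_between sX sY T"
    and p: "1 \<le> p" and x: "weakly_summable sX p x"
  shows "weakly_summable sY p (\<lambda>n. T (x n))"
proof (cases "p = \<infinity>")
  case True
  then show ?thesis
    using x bspec[where P = "\<lambda>g. (\<lambda>n. g (x n)) \<longlonglongrightarrow> 0", OF _ dual_space_compose[OF sX sY T]]
    unfolding weakly_summable_def by simp
next
  case False
  define q where "q = enn2real p"
  obtain C where C: "\<forall>f\<in>dual_ball sX. \<forall>A. finite A \<longrightarrow> (\<Sum>n\<in>A. norm (f (x n)) powr q) \<le> C"
    using x p False unfolding q_def by (auto simp: weakly_summable_finite_iff)
  obtain M where M: "0 < M" "\<And>x. norm (T x) \<le> norm x * M"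
    using bounded_linear.pos_bounded[OF operator_bounded_linear[OF sX sY T]] by blast
  have "(\<Sum>n\<in>A. norm (f (T (x n))) powr q) \<le> M powr q * C"
    if f: "f \<in> dual_ball sY" and A: "finite A" for f A
  proof -
    define g where "g x = f (T x) / of_real M" for x
    have "(\<lambda>x. f (T x)) \<in> dual_space sX"
      using f dual_space_compose[OF sX sY T] unfolding dual_ball_def by blast
    then have "f (T (x + y)) = f (T x) + f (T y)" "f (T (sX c x)) = c * f (T x)" for x y c
      using banach_space.linear_dual_iff[OF sX] unfolding dual_space_def by auto
    moreover have "norm (f (T x)) \<le> norm x * M" for x
      using f M(2) banach_space.dual_ball_iff[OF sY] order_trans by blast
    ultimately have "g \<in> dual_ball sX"
      using M(1) unfolding banach_space.dual_ball_iff[OF sX]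
      by (simp add: g_def add_divide_distrib norm_divide divide_le_eq)
    moreover have "norm (f (T (x n))) powr q = M powr q * norm (g (x n)) powr q" for n
      using M(1) by (simp add: g_def norm_divide powr_divide)
    ultimately show ?thesis
      using C A M(1) by (simp add: mult_left_mono flip: sum_distrib_left)
  qed
  then show ?thesis
    using p False unfolding q_def by (auto simp: weakly_summable_finite_iff)
qed

section \<open>Norm null images of weakly \<open>p\<close>-summable sequences\<close>

text \<open>
  A single term is one of the finite sums that a tail bounds, and a norming functional turns it into
  the norm.
\<close>

lemma unconditionally_summable_imp_null:
  assumes s: "banach_space s" and p: "1 \<le> p" and x: "unconditionally_summable s p x"
  shows "x \<longlonglongrightarrow> 0"
proof (cases "p = \<infinity>")
  case True
  then show ?thesis
    using x unfolding unconditionally_summable_def by simp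
next
  case False
  define q where "q = enn2real p"
  have q: "0 < q"
    using enn2real_ge_one[OF p False] unfolding q_def by simp
  have lim: "weak_tail s q x \<longlonglongrightarrow> 0"
    using x False unfolding unconditionally_summable_def q_def by simp
  show ?thesis
    unfolding LIMSEQ_def dist_0_norm
  proof (intro allI impI)
    fix e :: real assume e: "0 < e"
    then obtain m where m: "\<forall>f\<in>dual_ball s. \<forall>A. finite A \<longrightarrow> A \<subseteq> {m..} \<longrightarrow>
        (\<Sum>n\<in>A. norm (f (x n)) powr q) \<le> (e / 2) powr q"
      using lim unfolding weak_tail_tendsto_zero_iff[OF q] by (meson half_gt_zero)
    have "norm (x n) < e" if n: "m \<le> n" for n
    proof -
      obtain f where f: "f \<in> dual_ball s" "norm (f (x n)) = norm (x n)"
        using banach_space.norming_functional[OF s] by blast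
      have "norm (x n) powr q \<le> (e / 2) powr q"
        using m[rule_format, OF f(1), of "{n}"] n f(2) by simp
      then have "norm (x n) \<le> e / 2"
        using powr_less_mono2[of q "e / 2" "norm (x n)"] q e by (force simp: not_le[symmetric])
      then show ?thesis
        using e by simp
    qed
    then show "\<exists>m. \<forall>n\<ge>m. dist (x n) 0 < e"
      by auto
  qed
qed

text \<open>
  The common skeleton of the two subsequence constructions below: a property that some interval
  \<open>[m, N)\<close> has for every \<open>m\<close> holds along a sequence of adjacent intervals.
\<close>

lemma consecutive_intervals:
  assumes "\<And>m::nat. \<exists>N>m. P m N"
  obtains r :: "nat \<Rightarrow> nat" where "strict_mono r" and "\<And>i. P (r i) (r (Suc i))"
proof -
  obtain N where N: "\<And>m. m < N m \<and> P m (N m)"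
    using assms by metis
  show thesis
  proof
    show "strict_mono (\<lambda>i. (N ^^ i) 0)"
      using N by (simp add: strict_mono_Suc_iff)
    show "P ((N ^^ i) 0) ((N ^^ Suc i) 0)" for i
      using N by simp
  qed
qed

text \<open>
  The gliding hump argument: from tails that do not vanish it makes a weakly \<open>p\<close>-summable sequence
  of block sums whose images stay away from \<open>0\<close>.
\<close>

lemma tail_null_of_norm_null:
  assumes sX: "banach_space sX" and sY: "banach_space sY" and T: "operator_between sX sY T"
    and p: "1 \<le> p" "p \<noteq> \<infinity>" and x: "weakly_summable sX p x"
    and null: "\<And>z. weakly_summable sX p z \<Longrightarrow> (\<lambda>n. T (z n)) \<longlonglongrightarrow> 0"
  shows "weak_tail sY (enn2real p) (\<lambda>n. T (x n)) \<longlonglongrightarrow> 0"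
proof (rule ccontr)
  define q where "q = enn2real p"
  have q: "1 \<le> q" "0 < q"
    using enn2real_ge_one[OF p] unfolding q_def by simp_all
  assume "\<not> ?thesis"
  then obtain e where e: "0 < e" and tail: "\<And>m. \<exists>f\<in>dual_ball sY. \<exists>A. finite A \<and> A \<subseteq> {m..} \<and>
      e powr q < (\<Sum>n\<in>A. norm (f (T (x n))) powr q)"
    unfolding q_def[symmetric] weak_tail_tendsto_zero_iff[OF q(2)] by (auto simp: not_le)
  define block where "block m N A a \<longleftrightarrow> A \<subseteq> {m..<N} \<and> e < norm (T (\<Sum>n\<in>A. sX (a n) (x n))) \<and>
      (\<forall>c. norm (\<Sum>n\<in>A. a n * c n) powr q \<le> (\<Sum>n\<in>A. norm (c n) powr q))" for m N :: nat and A a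
  have "\<exists>N>m. \<exists>A a. block m N A a" for m
  proof -
    obtain f A where f: "f \<in> dual_ball sY" and A: "finite A" "A \<subseteq> {m..}"
      and large: "e powr q < (\<Sum>n\<in>A. norm (f (T (x n))) powr q)"
      using tail by blast
    let ?S = "\<Sum>n\<in>A. norm (f (T (x n))) powr q"
    have "0 < ?S"
      using large powr_ge_zero[of e q] by linarith
    then obtain a where a: "(\<Sum>n\<in>A. a n * f (T (x n))) = of_real (?S powr (1 / q))"
      and contr: "\<forall>c. norm (\<Sum>n\<in>A. a n * c n) powr q \<le> (\<Sum>n\<in>A. norm (c n) powr q)"
      by (rule holder_dual_coefficients[OF q(1) A(1)])
    have fT: "(\<lambda>x. f (T x)) \<in> dual_space sX"
      using f dual_space_compose[OF sX sY T] unfolding dual_ball_def by blast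
    have "f (T (\<Sum>n\<in>A. sX (a n) (x n))) = (\<Sum>n\<in>A. f (T (sX (a n) (x n))))"
      using linear_sum[OF bounded_linear.linear[OF banach_space.dual_space_bounded_linear[OF sX fT]]] .
    also have "\<dots> = (\<Sum>n\<in>A. a n * f (T (x n)))"
      using fT banach_space.linear_dual_iff[OF sX] unfolding dual_space_def by simp
    finally have "norm (f (T (\<Sum>n\<in>A. sX (a n) (x n)))) = ?S powr (1 / q)"
      using a by simp
    moreover have "norm (f (T (\<Sum>n\<in>A. sX (a n) (x n)))) \<le> norm (T (\<Sum>n\<in>A. sX (a n) (x n)))"
      using f banach_space.dual_ball_iff[OF sY] by blast
    moreover have "(e powr q) powr (1 / q) < ?S powr (1 / q)"
      using large q by (intro powr_less_mono2) auto
    ultimately have "e < norm (T (\<Sum>n\<in>A. sX (a n) (x n)))"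
      using e q by (simp add: powr_powr)
    moreover obtain N where "A \<subseteq> {..<N}"
      using A(1) finite_nat_iff_bounded by blast
    \<comment> \<open>the maximum keeps the right end beyond \<open>m\<close>, so that the intervals advance\<close>
    then have "A \<subseteq> {m..<max N (Suc m)}"
      using A(2) by (fastforce simp: less_max_iff_disj)
    ultimately have "block m (max N (Suc m)) A a"
      using contr unfolding block_def by blast
    then show ?thesis
      by (intro exI[of _ "max N (Suc m)"]) auto
  qed
  then obtain r where r: "strict_mono r" and "\<And>i. \<exists>A a. block (r i) (r (Suc i)) A a"
    using consecutive_intervals[where P = "\<lambda>m N. \<exists>A a. block m N A a"] by blast
  then obtain A a where blocks: "\<And>i. block (r i) (r (Suc i)) (A i) (a i)"
    by metis
  have A: "A i \<subseteq> {r i..<r (Suc i)}"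
    and large: "e < norm (T (\<Sum>n\<in>A i. sX (a i n) (x n)))"
    and contr: "norm (\<Sum>n\<in>A i. a i n * c n) powr q \<le> (\<Sum>n\<in>A i. norm (c n) powr q)" for i c
    using blocks[of i] unfolding block_def by auto
  have "A i \<inter> A j = {}" if "i < j" for i j
  proof -
    have "r (Suc i) \<le> r j"
      using r that by (simp add: strict_mono_less_eq)
    then show ?thesis
      using A[of i] A[of j] by fastforce
  qed
  then have "disjoint_family A"
    unfolding disjoint_family_on_def by (metis Int_commute linorder_neqE_nat)
  moreover have "finite (A i)" for i
    using A by (rule finite_subset) simp
  ultimately have "weakly_summable sX p (\<lambda>i. \<Sum>n\<in>A i. sX (a i n) (x n))"
    using contr unfolding q_def by (intro weakly_summable_blocks[OF sX p x]) auto
  then have "(\<lambda>i. norm (T (\<Sum>n\<in>A i. sX (a i n) (x n)))) \<longlonglongrightarrow> 0"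
    by (rule tendsto_norm_zero[OF null])
  then have "e \<le> 0"
    using large by (intro LIMSEQ_le_const[where X = "\<lambda>i. norm (T (\<Sum>n\<in>A i. sX (a i n) (x n)))"])
      (auto intro: less_imp_le)
  with e show False
    by simp
qed

text \<open>
  If the sequence were not Cauchy, pairs of indices with distant values could be chosen in adjacent
  intervals, which makes both index sequences strictly increasing.
\<close>

lemma Cauchy_of_subsequence_differences:
  fixes y :: "nat \<Rightarrow> 'b::real_normed_vector"
  assumes null: "\<And>k j :: nat \<Rightarrow> nat. strict_mono k \<Longrightarrow> strict_mono j \<Longrightarrow> (\<lambda>n. y (k n) - y (j n)) \<longlonglongrightarrow> 0"
  shows "Cauchy y"
proof (rule ccontr)
  assume "\<not> Cauchy y"
  then obtain e where e: "0 < e" and far: "\<And>M. \<exists>m\<ge>M. \<exists>n\<ge>M. e \<le> dist (y m) (y n)"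
    unfolding Cauchy_def by (meson not_le)
  define pair where "pair M N k j \<longleftrightarrow> M \<le> k \<and> k < N \<and> M \<le> j \<and> j < N \<and> e \<le> dist (y k) (y j)"
    for M N k j
  have "\<exists>N>M. \<exists>k j. pair M N k j" for M
  proof -
    obtain k j where "M \<le> k" "M \<le> j" "e \<le> dist (y k) (y j)"
      using far by blast
    then have "pair M (Suc (max k j)) k j" "M < Suc (max k j)"
      unfolding pair_def by auto
    then show ?thesis
      by blast
  qed
  then obtain r where "\<And>i. \<exists>k j. pair (r i) (r (Suc i)) k j"
    using consecutive_intervals[where P = "\<lambda>M N. \<exists>k j. pair M N k j"] by blast
  then obtain k j where kj: "\<And>i. pair (r i) (r (Suc i)) (k i) (j i)"
    by metis
  have "strict_mono k" "strict_mono j"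
    using kj unfolding strict_mono_Suc_iff pair_def by (meson less_le_trans)+
  then have "(\<lambda>n. norm (y (k n) - y (j n))) \<longlonglongrightarrow> 0"
    by (rule tendsto_norm_zero[OF null])
  moreover have "e \<le> norm (y (k n) - y (j n))" for n
    using kj[of n] unfolding pair_def dist_norm by blast
  ultimately have "e \<le> 0"
    by (intro LIMSEQ_le_const[where X = "\<lambda>n. norm (y (k n) - y (j n))"]) auto
  with e show False
    by simp
qed

section \<open>The equivalences\<close>

lemma unconditionally_converging_iff_null:
  assumes sX: "banach_space sX" and sY: "banach_space sY" and T: "operator_between sX sY T"
    and p: "1 \<le> p"
  shows "unconditionally_converging sX sY p T \<longleftrightarrow>
    (\<forall>x. weakly_summable sX p x \<longrightarrow> (\<lambda>n. T (x n)) \<longlonglongrightarrow> 0)"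
proof
  assume "unconditionally_converging sX sY p T"
  then show "\<forall>x. weakly_summable sX p x \<longrightarrow> (\<lambda>n. T (x n)) \<longlonglongrightarrow> 0"
    using unconditionally_summable_imp_null[OF sY p] unfolding unconditionally_converging_def by blast
next
  assume "\<forall>x. weakly_summable sX p x \<longrightarrow> (\<lambda>n. T (x n)) \<longlonglongrightarrow> 0"
  then show "unconditionally_converging sX sY p T"
    using tail_null_of_norm_null[OF sX sY T p] weakly_summable_image[OF sX sY T p]
    unfolding unconditionally_converging_def unconditionally_summable_def by auto
qed

lemma weakly_convergent_imp_weakly_Cauchy:
  assumes s: "banach_space s" and p: "1 \<le> p" and x: "weakly_convergent s p x"
  shows "weakly_Cauchy s p x"
  unfolding weakly_Cauchy_def
proof (intro allI impI)
  fix k j :: "nat \<Rightarrow> nat" assume kj: "strict_mono k" "strict_mono j"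
  obtain l where l: "weakly_summable s p (\<lambda>n. x n - l)"
    using x unfolding weakly_convergent_def weakly_convergent_to_def by blast
  have "weakly_summable s p (\<lambda>n. (x (k n) - l) - (x (j n) - l))"
    using weakly_summable_subseq[OF p l kj(1)] weakly_summable_subseq[OF p l kj(2)]
    by (rule banach_space.weakly_summable_diff[OF s p])
  then show "weakly_summable s p (\<lambda>n. x (k n) - x (j n))"
    by simp
qed

text \<open>
  A weakly \<open>p\<close>-summable sequence is weakly null, and norming functionals separate points.
\<close>

lemma limit_zero_of_weakly_summable:
  assumes s: "banach_space s" and p: "1 \<le> p" and x: "weakly_summable s p x" and lim: "x \<longlonglongrightarrow> l"
  shows "l = 0"
proof -
  obtain f where f: "f \<in> dual_ball s" "norm (f l) = norm l"
    using banach_space.norming_functional[OF s] by blast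
  have "f \<in> dual_space s"
    using f(1) unfolding dual_ball_def by blast
  then have "(\<lambda>n. f (x n)) \<longlonglongrightarrow> f l"
    using bounded_linear.tendsto[OF banach_space.dual_space_bounded_linear[OF s] lim] by blast
  then have "f l = 0"
    using weakly_summable_imp_weakly_null[OF p x f(1)] LIMSEQ_unique by blast
  then show ?thesis
    using f(2) by simp
qed

theorem theorem2p2:
  fixes sX :: "'k::real_or_complex \<Rightarrow> 'a::banach \<Rightarrow> 'a"
    and sY :: "'k \<Rightarrow> 'b::banach \<Rightarrow> 'b"
    and T :: "'a \<Rightarrow> 'b"
    and p :: ennreal
  assumes "1 \<le> p"
    and "banach_space sX" and "banach_space sY"
    and "operator_between sX sY T"
  shows "(unconditionally_converging sX sY p T \<longleftrightarrow>
            (\<forall>x. weakly_convergent sX p x \<longrightarrow> convergent (\<lambda>n. T (x n)))) \<and>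
         ((\<forall>x. weakly_convergent sX p x \<longrightarrow> convergent (\<lambda>n. T (x n))) \<longleftrightarrow>
            (\<forall>x. weakly_Cauchy sX p x \<longrightarrow> convergent (\<lambda>n. T (x n))))"
    (is "(?uc \<longleftrightarrow> ?conv) \<and> (?conv \<longleftrightarrow> ?Cauchy)")
proof -
  note p = assms(1) and sX = assms(2) and sY = assms(3) and T = assms(4)
  note uc_iff = unconditionally_converging_iff_null[OF sX sY T p]
  have diff: "T (a - b) = T a - T b" for a b
    using linear_diff[OF bounded_linear.linear[OF operator_bounded_linear[OF sX sY T]]] .
  have "?Cauchy" if ?uc
  proof (intro allI impI)
    fix x assume "weakly_Cauchy sX p x"
    then have "(\<lambda>n. T (x (k n)) - T (x (j n))) \<longlonglongrightarrow> 0" if "strict_mono k" "strict_mono j" for k j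
      using \<open>?uc\<close> that unfolding uc_iff weakly_Cauchy_def diff[symmetric] by blast
    then show "convergent (\<lambda>n. T (x n))"
      by (intro Cauchy_convergent Cauchy_of_subsequence_differences)
  qed
  moreover have "?conv" if ?Cauchy
    using that weakly_convergent_imp_weakly_Cauchy[OF sX p] by blast
  moreover have "?uc" if ?conv
    unfolding uc_iff
  proof (intro allI impI)
    fix x assume x: "weakly_summable sX p x"
    then have "weakly_convergent sX p x"
      unfolding weakly_convergent_def weakly_convergent_to_def by (intro exI[of _ 0]) simp
    then obtain l where "(\<lambda>n. T (x n)) \<longlonglongrightarrow> l"
      using \<open>?conv\<close> unfolding convergent_def by blast
    moreover have "l = 0"
      using limit_zero_of_weakly_summable[OF sY p weakly_summable_image[OF sX sY T p x]] calculation .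
    ultimately show "(\<lambda>n. T (x n)) \<longlonglongrightarrow> 0"
      by simp
  qed
  ultimately show ?thesis
    by blast
qed

end
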